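(* Let $\mu>0$, let $H=L^2((0,\infty);\sqrt\omega\,d\omega)$, let $\Pi$ denote the orthogonal projection of $H$ onto $\operatorname{Ker}(L_\mu)$, and let $\lambda_\mu>0$ be a spectral gap constant, i.e. $-\langle L_\mu g,g\rangle_H\ge\lambda_\mu\|(I-\Pi)g\|_H^2$ for all $g\in H$. Then the linear semigroup $S(t)=e^{tL_\mu}$ satisfies, for all $t\ge0$ and all $g\in H$, $$\|S(t)(I-\Pi)g\|_H\le e^{-\lambda_\mu t}\|(I-\Pi)g\|_H.$$
   Context: $H$ consists of real-valued functions and carries its natural inner product. $L_\mu$ is the bounded self-adjoint operator on $H$ which extends by density, from $g\in C_c^\infty(0,\infty)$, $$L_\mu g(\omega)=\iint_{D(\omega)}\Omega\,n_1n_2n_3\Big[-\frac{g(\omega)}{n(\omega)}-\frac{g_3}{n_3}+\frac{g_1}{n_1}+\frac{g_2}{n_2}\Big]d\omega_1d\omega_2,$$ where $n(\omega)=\frac1{\omega+\mu}$, $D(\omega)=\{\omega_1\ge0,\ \omega_2\ge0,\ \omega_1+\omega_2\ge\omega\}$, $\omega_3=\omega_1+\omega_2-\omega$, $\Omega=\min(\sqrt\omega,\sqrt{\omega_1},\sqrt{\omega_2},\sqrt{\omega_3})/\sqrt\omega$, $n_i=n(\omega_i)$, $g_i=g(\omega_i)$. *)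

theory Defs
  imports "HOL-Analysis.Analysis"
begin

section \<open>The real Hilbert space of square-integrable functions on the half-line, with weight sqrt\<close>

definition wmeas :: "real measure" where
  "wmeas = density (restrict_space lborel {0<..}) (\<lambda>\<omega>. ennreal (sqrt \<omega>))"

definition L2_fun :: "(real \<Rightarrow> real) \<Rightarrow> bool" where
  "L2_fun f \<longleftrightarrow> f \<in> borel_measurable wmeas \<and> integrable wmeas (\<lambda>\<omega>. (f \<omega>)\<^sup>2)"

lemma L2_fun_measurable [measurable_dest]: "L2_fun f \<Longrightarrow> f \<in> borel_measurable wmeas"
  by (simp add: L2_fun_def)

lemma L2_fun_0: "L2_fun (\<lambda>_. 0)"
  by (simp add: L2_fun_def)

lemma L2_fun_mult_integrable:
  assumes "L2_fun f" "L2_fun g"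
  shows "integrable wmeas (\<lambda>\<omega>. f \<omega> * g \<omega>)"
proof (rule Bochner_Integration.integrable_bound)
  show "integrable wmeas (\<lambda>\<omega>. (f \<omega>)\<^sup>2 + (g \<omega>)\<^sup>2)"
    using assms by (auto simp: L2_fun_def)
  show "(\<lambda>\<omega>. f \<omega> * g \<omega>) \<in> borel_measurable wmeas"
    using assms by (auto simp: L2_fun_def)
  have "\<bar>a * b\<bar> \<le> a\<^sup>2 + b\<^sup>2" for a b :: real
  proof -
    have "2 * (\<bar>a\<bar> * \<bar>b\<bar>) \<le> a\<^sup>2 + b\<^sup>2"
      using sum_squares_bound[of "\<bar>a\<bar>" "\<bar>b\<bar>"] by simp
    moreover have "0 \<le> \<bar>a\<bar> * \<bar>b\<bar>" by simp
    ultimately show ?thesis unfolding abs_mult by linarith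
  qed
  then show "AE \<omega> in wmeas. norm (f \<omega> * g \<omega>) \<le> norm ((f \<omega>)\<^sup>2 + (g \<omega>)\<^sup>2)"
    by (auto simp: abs_of_nonneg)
qed

lemma L2_fun_add:
  assumes "L2_fun f" "L2_fun g"
  shows "L2_fun (\<lambda>\<omega>. f \<omega> + g \<omega>)"
  using assms L2_fun_mult_integrable[OF assms]
  by (auto simp: L2_fun_def power2_sum mult.assoc)

lemma L2_fun_scale: "L2_fun f \<Longrightarrow> L2_fun (\<lambda>\<omega>. r * f \<omega>)"
  by (auto simp: L2_fun_def power_mult_distrib)

lemma L2_fun_minus: "L2_fun f \<Longrightarrow> L2_fun (\<lambda>\<omega>. - f \<omega>)"
  using L2_fun_scale[of f "-1"] by simp

lemma L2_fun_diff: "L2_fun f \<Longrightarrow> L2_fun g \<Longrightarrow> L2_fun (\<lambda>\<omega>. f \<omega> - g \<omega>)"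
  using L2_fun_add[OF _ L2_fun_minus] by simp

quotient_type wL2 = "real \<Rightarrow> real" /
  partial: "\<lambda>f g. L2_fun f \<and> L2_fun g \<and> (AE \<omega> in wmeas. f \<omega> = g \<omega>)"
proof (rule part_equivpI)
  show "\<exists>f. L2_fun f \<and> L2_fun f \<and> (AE \<omega> in wmeas. f \<omega> = f \<omega>)"
    using L2_fun_0 by auto
  show "symp (\<lambda>f g. L2_fun f \<and> L2_fun g \<and> (AE \<omega> in wmeas. f \<omega> = g \<omega>))"
    by (auto intro!: sympI)
  show "transp (\<lambda>f g. L2_fun f \<and> L2_fun g \<and> (AE \<omega> in wmeas. f \<omega> = g \<omega>))"
    by (intro transpI) auto
qed

instantiation wL2 :: real_vector
begin

lift_definition zero_wL2 :: wL2 is "\<lambda>_. 0"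
  by (simp add: L2_fun_0)

lift_definition plus_wL2 :: "wL2 \<Rightarrow> wL2 \<Rightarrow> wL2" is "\<lambda>f g \<omega>. f \<omega> + g \<omega>"
  by (auto simp: L2_fun_add)

lift_definition minus_wL2 :: "wL2 \<Rightarrow> wL2 \<Rightarrow> wL2" is "\<lambda>f g \<omega>. f \<omega> - g \<omega>"
  by (auto simp: L2_fun_diff)

lift_definition uminus_wL2 :: "wL2 \<Rightarrow> wL2" is "\<lambda>f \<omega>. - f \<omega>"
  by (auto simp: L2_fun_minus)

lift_definition scaleR_wL2 :: "real \<Rightarrow> wL2 \<Rightarrow> wL2" is "\<lambda>r f \<omega>. r * f \<omega>"
  by (auto simp: L2_fun_scale)

instance
proof
  fix x y z :: wL2 and r s :: real
  show "x + y + z = x + (y + z)"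
    by transfer (auto simp: L2_fun_add add.assoc)
  show "x + y = y + x"
    by transfer (auto simp: L2_fun_add add.commute)
  show "0 + x = x" by transfer auto
  show "- x + x = 0" by transfer (auto simp: L2_fun_0)
  show "x - y = x + - y" by transfer (auto simp: L2_fun_diff)
  show "r *\<^sub>R (x + y) = r *\<^sub>R x + r *\<^sub>R y"
    by transfer (auto simp: L2_fun_add L2_fun_scale distrib_left)
  show "(r + s) *\<^sub>R x = r *\<^sub>R x + s *\<^sub>R x"
    by transfer (auto simp: L2_fun_add L2_fun_scale distrib_right)
  show "r *\<^sub>R s *\<^sub>R x = (r * s) *\<^sub>R x"
    by transfer (auto simp: L2_fun_scale mult.assoc)
  show "1 *\<^sub>R x = x" by transfer auto
qed

end

instantiation wL2 :: real_inner
begin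

lift_definition inner_wL2 :: "wL2 \<Rightarrow> wL2 \<Rightarrow> real" is "\<lambda>f g. \<integral>\<omega>. f \<omega> * g \<omega> \<partial>wmeas"
proof -
  fix f f' g g'
  assume a: "L2_fun f \<and> L2_fun f' \<and> (AE \<omega> in wmeas. f \<omega> = f' \<omega>)"
    "L2_fun g \<and> L2_fun g' \<and> (AE \<omega> in wmeas. g \<omega> = g' \<omega>)"
  then have [measurable]: "f \<in> borel_measurable wmeas" "f' \<in> borel_measurable wmeas"
     "g \<in> borel_measurable wmeas" "g' \<in> borel_measurable wmeas"
    by (auto simp: L2_fun_def)
  show "(\<integral>\<omega>. f \<omega> * g \<omega> \<partial>wmeas) = (\<integral>\<omega>. f' \<omega> * g' \<omega> \<partial>wmeas)"
    using a by (intro integral_cong_AE) auto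
qed

definition norm_wL2 :: "wL2 \<Rightarrow> real" where "norm_wL2 f = sqrt (inner f f)"
definition dist_wL2 :: "wL2 \<Rightarrow> wL2 \<Rightarrow> real" where "dist_wL2 f g = norm (f - g)"
definition sgn_wL2 :: "wL2 \<Rightarrow> wL2" where "sgn_wL2 f = f /\<^sub>R norm f"
definition uniformity_wL2 :: "(wL2 \<times> wL2) filter" where
  "uniformity_wL2 = (INF e\<in>{0 <..}. principal {(x, y). dist x y < e})"
definition open_wL2 :: "wL2 set \<Rightarrow> bool" where
  "open_wL2 U \<longleftrightarrow> (\<forall>x\<in>U. \<forall>\<^sub>F (x', y) in uniformity. x' = x \<longrightarrow> y \<in> U)"

instance
proof
  fix x y z :: wL2 and r :: real
  show "dist x y = norm (x - y)" by (rule dist_wL2_def)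
  show "sgn x = x /\<^sub>R norm x" by (rule sgn_wL2_def)
  show "uniformity = (INF e\<in>{0 <..}. principal {(x :: wL2, y). dist x y < e})"
    by (rule uniformity_wL2_def)
  show "open U = (\<forall>x\<in>U. \<forall>\<^sub>F (x', y) in uniformity. x' = x \<longrightarrow> y \<in> U)" for U :: "wL2 set"
    by (rule open_wL2_def)
  show "inner x y = inner y x" by transfer (simp add: mult.commute)
  show "inner (x + y) z = inner x z + inner y z"
    by transfer (auto simp: distrib_right L2_fun_mult_integrable)
  show "inner (r *\<^sub>R x) y = r * inner x y"
    by transfer (simp add: mult.assoc)
  show "0 \<le> inner x x" by transfer simp
  show "inner x x = 0 \<longleftrightarrow> x = 0"
  proof transfer
    fix x :: "real \<Rightarrow> real"
    assume "L2_fun x \<and> L2_fun x \<and> (AE \<omega> in wmeas. x \<omega> = x \<omega>)"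
    then show "((\<integral>\<omega>. x \<omega> * x \<omega> \<partial>wmeas) = 0) =
        (L2_fun x \<and> L2_fun (\<lambda>_. 0) \<and> (AE \<omega> in wmeas. x \<omega> = 0))"
      by (subst integral_nonneg_eq_0_iff_AE) (auto simp: L2_fun_0 L2_fun_mult_integrable)
  qed
  show "norm x = sqrt (inner x x)" by (rule norm_wL2_def)
qed

end

lemma L2_fun_rep: "L2_fun (rep_wL2 x)"
  using Quotient_rep_reflp[OF Quotient_wL2] by auto

lemma abs_rep_wL2 [simp]: "abs_wL2 (rep_wL2 x) = x"
  using Quotient_abs_rep[OF Quotient_wL2] .

lemma rep_abs_wL2:
  assumes "L2_fun f" shows "AE \<omega> in wmeas. rep_wL2 (abs_wL2 f) \<omega> = f \<omega>"
  using rep_abs_rsp_left[OF Quotient3_wL2, of f f] assms by auto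

lemma abs_wL2_diff:
  "L2_fun f \<Longrightarrow> L2_fun g \<Longrightarrow> abs_wL2 f - abs_wL2 g = abs_wL2 (\<lambda>\<omega>. f \<omega> - g \<omega>)"
  by (simp add: minus_wL2.abs_eq)

lemma norm_abs_wL2:
  assumes "L2_fun f"
  shows "ennreal ((norm (abs_wL2 f))\<^sup>2) = (\<integral>\<^sup>+\<omega>. ennreal ((f \<omega>)\<^sup>2) \<partial>wmeas)"
proof -
  have "(norm (abs_wL2 f))\<^sup>2 = (\<integral>\<omega>. (f \<omega>)\<^sup>2 \<partial>wmeas)"
    unfolding power2_norm_eq_inner using assms by (simp add: inner_wL2.abs_eq power2_eq_square)
  then show ?thesis
    using assms by (simp add: nn_integral_eq_integral L2_fun_def)
qed

lemma L2_Cauchy_limit: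
  fixes f :: "nat \<Rightarrow> real \<Rightarrow> real"
  assumes L2: "\<And>n. L2_fun (f n)"
    and d: "\<And>m n. m \<le> n \<Longrightarrow> (\<integral>\<^sup>+\<omega>. ennreal ((f n \<omega> - f m \<omega>)\<^sup>2) \<partial>wmeas) \<le> ennreal ((1/4)^m)"
  shows "\<exists>F. L2_fun F \<and> (\<forall>m. (\<integral>\<^sup>+\<omega>. ennreal ((F \<omega> - f m \<omega>)\<^sup>2) \<partial>wmeas) \<le> ennreal ((1/4)^m))"
proof -
  have [measurable]: "f n \<in> borel_measurable wmeas" for n
    using L2 by (simp add: L2_fun_def)
  define u where "u k \<omega> = ennreal (2^k * (f (Suc k) \<omega> - f k \<omega>)\<^sup>2)" for k \<omega>
  have [measurable]: "u k \<in> borel_measurable wmeas" for k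
    unfolding u_def by measurable
  have u: "(\<integral>\<^sup>+\<omega>. u k \<omega> \<partial>wmeas) \<le> ennreal ((1/2)^k)" for k
  proof -
    have "(\<integral>\<^sup>+\<omega>. u k \<omega> \<partial>wmeas) = ennreal (2^k) * (\<integral>\<^sup>+\<omega>. ennreal ((f (Suc k) \<omega> - f k \<omega>)\<^sup>2) \<partial>wmeas)"
      unfolding u_def by (simp add: ennreal_mult nn_integral_cmult)
    also have "\<dots> \<le> ennreal (2^k) * ennreal ((1/4)^k)"
      by (intro mult_left_mono d) auto
    also have "\<dots> = ennreal (2^k * (1/4)^k)"
      by (rule ennreal_mult[symmetric]) auto
    also have "(2::real)^k * (1/4)^k = (1/2)^k"
      by (simp flip: power_mult_distrib)
    finally show ?thesis .
  qed
  have "(\<integral>\<^sup>+\<omega>. (\<Sum>k. u k \<omega>) \<partial>wmeas) = (\<Sum>k. \<integral>\<^sup>+\<omega>. u k \<omega> \<partial>wmeas)"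
    by (rule nn_integral_suminf) auto
  also have "\<dots> \<le> (\<Sum>k. ennreal ((1/2)^k))"
    by (intro suminf_le u) auto
  also have "\<dots> = ennreal (\<Sum>k. (1/2)^k)"
    by (intro suminf_ennreal2) (auto intro: summable_geometric)
  also have "\<dots> < \<infinity>" by simp
  finally have "AE \<omega> in wmeas. (\<Sum>k. u k \<omega>) \<noteq> \<infinity>"
    by (intro nn_integral_PInf_AE) auto
  then have conv: "AE \<omega> in wmeas. convergent (\<lambda>n. f n \<omega>)"
  proof eventually_elim
    case (elim \<omega>)
    have fin: "(\<Sum>k. u k \<omega>) < \<infinity>" using elim by (simp add: less_top)
    obtain C where C: "0 \<le> C" "(\<Sum>k. u k \<omega>) = ennreal C"
      using fin by (cases "\<Sum>k. u k \<omega>") auto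
    have b: "\<bar>f (Suc k) \<omega> - f k \<omega>\<bar> \<le> sqrt C * (sqrt (1/2))^k" for k
    proof -
      have "u k \<omega> \<le> (\<Sum>k. u k \<omega>)"
        using sum_le_suminf[of "\<lambda>k. u k \<omega>" "{k}"] by simp
      then have "ennreal (2^k * (f (Suc k) \<omega> - f k \<omega>)\<^sup>2) \<le> ennreal C"
        unfolding C(2) by (simp only: u_def)
      then have "2^k * (f (Suc k) \<omega> - f k \<omega>)\<^sup>2 \<le> C"
        using C(1) by (simp only: ennreal_le_iff)
      then have "(f (Suc k) \<omega> - f k \<omega>)\<^sup>2 \<le> C * (1/2)^k"
        by (simp add: field_simps)
      then have "sqrt ((f (Suc k) \<omega> - f k \<omega>)\<^sup>2) \<le> sqrt (C * (1/2)^k)"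
        by (rule real_sqrt_le_mono)
      then show ?thesis unfolding real_sqrt_abs by (simp add: real_sqrt_mult real_sqrt_power)
    qed
    have "sqrt (1/2) < sqrt 1" by (subst real_sqrt_less_iff) simp
    then have "summable (\<lambda>k. sqrt C * (sqrt (1/2))^k)"
      by (intro summable_mult summable_geometric) simp
    then have "summable (\<lambda>k. f (Suc k) \<omega> - f k \<omega>)"
      by (rule summable_comparison_test'[where N=0]) (simp add: b)
    then have "convergent (\<lambda>n. \<Sum>k<n. f (Suc k) \<omega> - f k \<omega>)"
      by (simp add: summable_iff_convergent)
    then have "convergent (\<lambda>n. (\<Sum>k<n. f (Suc k) \<omega> - f k \<omega>) + f 0 \<omega>)"
      by (intro convergent_add convergent_const)
    moreover have "(\<Sum>k<n. f (Suc k) \<omega> - f k \<omega>) + f 0 \<omega> = f n \<omega>" for n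
      by (induction n) auto
    ultimately show ?case by simp
  qed
  define F where "F \<omega> = lim (\<lambda>n. f n \<omega>)" for \<omega>
  have [measurable]: "F \<in> borel_measurable wmeas"
    unfolding F_def by measurable
  have bd: "(\<integral>\<^sup>+\<omega>. ennreal ((F \<omega> - f m \<omega>)\<^sup>2) \<partial>wmeas) \<le> ennreal ((1/4)^m)" for m
  proof -
    have "(\<integral>\<^sup>+\<omega>. ennreal ((F \<omega> - f m \<omega>)\<^sup>2) \<partial>wmeas)
        = (\<integral>\<^sup>+\<omega>. liminf (\<lambda>n. ennreal ((f n \<omega> - f m \<omega>)\<^sup>2)) \<partial>wmeas)"
    proof (rule nn_integral_cong_AE, use conv in eventually_elim)
      case (elim \<omega>)
      then have "(\<lambda>n. f n \<omega>) \<longlonglongrightarrow> F \<omega>"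
        by (simp add: F_def convergent_LIMSEQ_iff)
      then have "(\<lambda>n. ennreal ((f n \<omega> - f m \<omega>)\<^sup>2)) \<longlonglongrightarrow> ennreal ((F \<omega> - f m \<omega>)\<^sup>2)"
        by (intro tendsto_ennrealI tendsto_intros)
      from lim_imp_Liminf[OF _ this] show ?case by simp
    qed
    also have "\<dots> \<le> liminf (\<lambda>n. \<integral>\<^sup>+\<omega>. ennreal ((f n \<omega> - f m \<omega>)\<^sup>2) \<partial>wmeas)"
      by (rule nn_integral_liminf) auto
    also have "\<dots> \<le> liminf (\<lambda>n. ennreal ((1/4)^m))"
      by (rule Liminf_mono) (auto intro!: eventually_sequentiallyI[of m] d)
    also have "\<dots> = ennreal ((1/4)^m)"
      by (simp add: Liminf_const)
    finally show ?thesis .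
  qed
  have "L2_fun (\<lambda>\<omega>. F \<omega> - f 0 \<omega>)"
    unfolding L2_fun_def
  proof
    show "(\<lambda>\<omega>. F \<omega> - f 0 \<omega>) \<in> borel_measurable wmeas" by measurable
    show "integrable wmeas (\<lambda>\<omega>. (F \<omega> - f 0 \<omega>)\<^sup>2)"
      using le_less_trans[OF bd[of 0]] by (intro integrableI_bounded) auto
  qed
  from L2_fun_add[OF this L2[of 0]] have "L2_fun F" by simp
  with bd show ?thesis by blast
qed

instance wL2 :: complete_space
proof
  fix X :: "nat \<Rightarrow> wL2"
  assume X: "Cauchy X"
  have "\<exists>N. \<forall>m\<ge>N. \<forall>n\<ge>N. norm (X m - X n) < (1/2)^k" for k
    using X unfolding Cauchy_iff by (meson zero_less_power half_gt_zero_iff zero_less_one)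
  then obtain N where N: "\<And>k m n. m \<ge> N k \<Longrightarrow> n \<ge> N k \<Longrightarrow> norm (X m - X n) < (1/2)^k"
    by metis
  define r where "r k = (\<Sum>i\<le>k. N i + 1)" for k
  have mono: "strict_mono r"
    by (rule strict_monoI_Suc) (simp add: r_def)
  have rN: "N m \<le> r n" if "m \<le> n" for m n
  proof -
    have "N m + 1 \<le> r n"
      unfolding r_def by (rule member_le_sum[where f="\<lambda>i. N i + 1"]) (use that in auto)
    then show ?thesis by simp
  qed
  define f where "f k = rep_wL2 (X (r k))" for k
  have f: "L2_fun (f k)" "abs_wL2 (f k) = X (r k)" for k
    by (auto simp: f_def L2_fun_rep)
  have nrm: "(\<integral>\<^sup>+\<omega>. ennreal ((F \<omega> - f m \<omega>)\<^sup>2) \<partial>wmeas) = ennreal ((norm (abs_wL2 F - X (r m)))\<^sup>2)"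
    if "L2_fun F" for F m
    using norm_abs_wL2[OF L2_fun_diff[OF that f(1)[of m]]]
    by (simp add: abs_wL2_diff[OF that f(1), symmetric] f(2))
  have q: "((1/2)^m)\<^sup>2 = ((1/4)::real)^m" for m
    by (simp add: power2_eq_square flip: power_mult_distrib)
  have "\<exists>F. L2_fun F \<and> (\<forall>m. (\<integral>\<^sup>+\<omega>. ennreal ((F \<omega> - f m \<omega>)\<^sup>2) \<partial>wmeas) \<le> ennreal ((1/4)^m))"
  proof (rule L2_Cauchy_limit)
    fix m n :: nat assume "m \<le> n"
    then have "norm (X (r n) - X (r m)) \<le> (1/2)^m"
      using N[OF rN[of m n] rN[of m m]] by simp
    then have "(norm (X (r n) - X (r m)))\<^sup>2 \<le> ((1/2)^m)\<^sup>2"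
      by (intro power_mono) auto
    then show "(\<integral>\<^sup>+\<omega>. ennreal ((f n \<omega> - f m \<omega>)\<^sup>2) \<partial>wmeas) \<le> ennreal ((1/4)^m)"
      by (simp add: nrm f q ennreal_leI)
  qed (rule f)
  then obtain F where F: "L2_fun F"
    "\<And>m. (\<integral>\<^sup>+\<omega>. ennreal ((F \<omega> - f m \<omega>)\<^sup>2) \<partial>wmeas) \<le> ennreal ((1/4)^m)" by blast
  have le: "norm (X (r m) - abs_wL2 F) \<le> (1/2)^m" for m
  proof (rule power2_le_imp_le)
    show "(norm (X (r m) - abs_wL2 F))\<^sup>2 \<le> ((1/2)^m)\<^sup>2"
      using F(2)[of m] by (simp add: nrm[OF F(1)] q norm_minus_commute)
  qed simp
  have "(\<lambda>m. (1/2::real)^m) \<longlonglongrightarrow> 0" by (intro LIMSEQ_realpow_zero) auto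
  then have "(\<lambda>m. X (r m) - abs_wL2 F) \<longlonglongrightarrow> 0"
    by (rule Lim_null_comparison[rotated]) (simp add: le)
  then have "(X \<circ> r) \<longlonglongrightarrow> abs_wL2 F"
    by (simp add: LIM_zero_iff o_def)
  then show "convergent X"
    using Cauchy_converges_subseq[OF X mono] by (auto simp: convergent_def)
qed

instance wL2 :: banach ..

section \<open>The operator\<close>

definition test_fun :: "(real \<Rightarrow> real) \<Rightarrow> bool" where
  "test_fun g \<longleftrightarrow>
     (\<forall>k x. (deriv ^^ k) g differentiable (at x)) \<and>
     compact (closure {x. g x \<noteq> 0}) \<and> closure {x. g x \<noteq> 0} \<subseteq> {0<..}"

lemma test_fun_L2:
  assumes "test_fun g" shows "L2_fun g"
proof -
  define K where "K = closure {x. g x \<noteq> 0}"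
  have K: "compact K" "K \<subseteq> {0<..}" "\<And>x. x \<notin> K \<Longrightarrow> g x = 0"
    using assms closure_subset[of "{x. g x \<noteq> 0}"] by (auto simp: test_fun_def K_def)
  have "(deriv ^^ 0) g differentiable (at x)" for x
    using assms unfolding test_fun_def by blast
  then have cont: "continuous_on UNIV g"
    by (auto intro!: continuous_at_imp_continuous_on differentiable_imp_continuous_within)
  then have meas [measurable]: "g \<in> borel_measurable borel"
    by (rule borel_measurable_continuous_onI)
  have mr: "(\<lambda>\<omega>. g \<omega>) \<in> borel_measurable (restrict_space lborel {0<..})"
    by (rule measurable_restrict_space1) simp
  then have "g \<in> borel_measurable wmeas"
    by (simp add: wmeas_def)
  moreover have "integrable wmeas (\<lambda>\<omega>. (g \<omega>)\<^sup>2)"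
  proof -
    have "integrable lborel (\<lambda>\<omega>. indicator K \<omega> *\<^sub>R (sqrt \<omega> * (g \<omega>)\<^sup>2))"
      by (intro borel_integrable_compact K(1) continuous_intros continuous_on_subset[OF cont]) auto
    also have "(\<lambda>\<omega>. indicator K \<omega> *\<^sub>R (sqrt \<omega> * (g \<omega>)\<^sup>2)) =
        (\<lambda>\<omega>. indicator {0<..} \<omega> *\<^sub>R (sqrt \<omega> * (g \<omega>)\<^sup>2))"
      using K(2,3) by (auto simp: fun_eq_iff indicator_def)
    finally have "integrable (restrict_space lborel {0<..}) (\<lambda>\<omega>. sqrt \<omega> *\<^sub>R (g \<omega>)\<^sup>2)"
      by (subst integrable_restrict_space) auto
    moreover have "AE \<omega> in restrict_space lborel {0<..}. 0 \<le> sqrt \<omega>"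
      by (rule AE_I2) (auto simp: space_restrict_space)
    moreover have "sqrt \<in> borel_measurable (restrict_space lborel {0<..})"
      by (rule measurable_restrict_space1) simp
    ultimately show ?thesis
      unfolding wmeas_def using mr by (subst integrable_density) auto
  qed
  ultimately show ?thesis by (simp add: L2_fun_def)
qed

definition dens :: "real \<Rightarrow> real \<Rightarrow> real" where
  "dens \<mu> \<omega> = 1 / (\<omega> + \<mu>)"

definition res_dom :: "real \<Rightarrow> (real \<times> real) set" where
  "res_dom \<omega> = {(\<omega>\<^sub>1, \<omega>\<^sub>2). 0 \<le> \<omega>\<^sub>1 \<and> 0 \<le> \<omega>\<^sub>2 \<and> \<omega> \<le> \<omega>\<^sub>1 + \<omega>\<^sub>2}"

definition Omega :: "real \<Rightarrow> real \<Rightarrow> real \<Rightarrow> real \<Rightarrow> real" where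
  "Omega \<omega> \<omega>\<^sub>1 \<omega>\<^sub>2 \<omega>\<^sub>3 =
     min (sqrt \<omega>) (min (sqrt \<omega>\<^sub>1) (min (sqrt \<omega>\<^sub>2) (sqrt \<omega>\<^sub>3))) / sqrt \<omega>"

definition L_formula :: "real \<Rightarrow> (real \<Rightarrow> real) \<Rightarrow> real \<Rightarrow> real" where
  "L_formula \<mu> g \<omega> =
     (LINT (\<omega>\<^sub>1, \<omega>\<^sub>2) : res_dom \<omega> | lborel.
        (let \<omega>\<^sub>3 = \<omega>\<^sub>1 + \<omega>\<^sub>2 - \<omega>; n = dens \<mu> in
          Omega \<omega> \<omega>\<^sub>1 \<omega>\<^sub>2 \<omega>\<^sub>3 * n \<omega>\<^sub>1 * n \<omega>\<^sub>2 * n \<omega>\<^sub>3 *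
            (- (g \<omega> / n \<omega>) - g \<omega>\<^sub>3 / n \<omega>\<^sub>3 + g \<omega>\<^sub>1 / n \<omega>\<^sub>1 + g \<omega>\<^sub>2 / n \<omega>\<^sub>2)))"

definition self_adjoint :: "('a::real_inner \<Rightarrow>\<^sub>L 'a) \<Rightarrow> bool" where
  "self_adjoint L \<longleftrightarrow> (\<forall>f g. inner (blinfun_apply L f) g = inner f (blinfun_apply L g))"

(* The bounded self-adjoint extension of the integral formula from test functions to the whole
   space. Test functions are dense, so at most one L satisfies this. Boundedness is part of the
   type of L; abs_wL2 g is the class of g, and rep_wL2 picks a representative of a class. *)
definition is_L :: "real \<Rightarrow> (wL2 \<Rightarrow>\<^sub>L wL2) \<Rightarrow> bool" where
  "is_L \<mu> L \<longleftrightarrow> self_adjoint L \<and>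
     (\<forall>g. test_fun g \<longrightarrow>
        (AE \<omega> in wmeas. rep_wL2 (blinfun_apply L (abs_wL2 g)) \<omega> = L_formula \<mu> g \<omega>))"

section \<open>Kernel, orthogonal projection, and semigroup\<close>

definition ker :: "('a::real_normed_vector \<Rightarrow>\<^sub>L 'b::real_normed_vector) \<Rightarrow> 'a set" where
  "ker L = {g. blinfun_apply L g = 0}"

(* Well defined for closed subspaces V of a complete space, in particular for V = ker L. *)
definition orth_proj :: "'a::real_inner set \<Rightarrow> 'a \<Rightarrow> 'a" where
  "orth_proj V g = (THE p. p \<in> V \<and> (\<forall>v\<in>V. inner (g - p) v = 0))"

primrec blinfun_power :: "('a::real_normed_vector \<Rightarrow>\<^sub>L 'a) \<Rightarrow> nat \<Rightarrow> ('a \<Rightarrow>\<^sub>L 'a)" where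
  "blinfun_power A 0 = id_blinfun"
| "blinfun_power A (Suc k) = A o\<^sub>L blinfun_power A k"

(* The exponential series, convergent in operator norm. *)
definition blinfun_exp :: "('a::banach \<Rightarrow>\<^sub>L 'a) \<Rightarrow> ('a \<Rightarrow>\<^sub>L 'a)" where
  "blinfun_exp A = (\<Sum>k. blinfun_power A k /\<^sub>R fact k)"

definition op_semigroup :: "('a::banach \<Rightarrow>\<^sub>L 'a) \<Rightarrow> real \<Rightarrow> ('a \<Rightarrow>\<^sub>L 'a)" where
  "op_semigroup A t = blinfun_exp (t *\<^sub>R A)"

end

theory Submission
  imports Defs
begin

text \<open>
  Let \<open>P\<close> be the orthogonal projection onto \<open>ker L\<close> and \<open>u t\<close> the orbit of \<open>g - P g\<close> under the
  semigroup. Along this orbit the squared norm has derivative \<open>2 * inner (L (u t)) (u t)\<close>, which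
  the spectral gap bounds by \<open>- 2 * gap * (norm (u t - P (u t)))\<^sup>2\<close>. The point is that the projection
  disappears: for \<open>k\<close> in the kernel, \<open>inner (u t) k\<close> has derivative
  \<open>inner (L (u t)) k = inner (u t) (L k) = 0\<close> by self-adjointness, so an orbit that starts
  orthogonal to the kernel stays so (\<open>op_semigroup_orthogonal_ker\<close>) and \<open>P (u t) = 0\<close>. What is left is
  the differential inequality \<open>(norm u\<^sup>2)' \<le> - 2 * gap * norm u\<^sup>2\<close>, and Gronwall's argument gives the
  exponential rate (\<open>exp_decay_of_energy_inequality\<close>). This is an argument about bounded
  self-adjoint operators on an arbitrary real Hilbert space (\<open>op_semigroup_exp_decay\<close>).

  Two general facts support this. The projection onto a closed subspace exists
  (\<open>closed_subspace_orthogonal_decomposition\<close>), so that \<open>g - P g\<close> really is orthogonal to the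
  kernel. The exponential series may be differentiated term by term
  (\<open>op_semigroup_has_vector_derivative\<close>), so that orbits solve \<open>u' = L u\<close>.
\<close>

section \<open>Orthogonal projections in real Hilbert spaces\<close>

text \<open>
  Completeness replaces compactness here: the parallelogram law makes every sequence in \<open>V\<close> that
  minimises the distance to \<open>g\<close> a Cauchy sequence, and its limit is the foot of the perpendicular,
  because otherwise a small step within \<open>V\<close> would bring it closer to \<open>g\<close>.
\<close>

lemma closed_subspace_orthogonal_decomposition:
  fixes V :: "'a::{real_inner, complete_space} set"
  assumes V: "subspace V" "closed V"
  shows "\<exists>p\<in>V. \<forall>v\<in>V. inner (g - p) v = 0"
proof -
  define d where "d = (INF v\<in>V. (norm (v - g))\<^sup>2)"
  have ne: "V \<noteq> {}" using subspace_0[OF V(1)] by auto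
  have bdd: "bdd_below ((\<lambda>v. (norm (v - g))\<^sup>2) ` V)"
    by (rule bdd_belowI[of _ 0]) auto
  have d_le: "d \<le> (norm (v - g))\<^sup>2" if "v \<in> V" for v
    unfolding d_def using bdd that by (rule cINF_lower)
  have "\<exists>v\<in>V. (norm (v - g))\<^sup>2 < d + 1 / real (Suc n)" for n
    using cINF_less_iff[OF ne bdd, of "d + 1 / real (Suc n)"]
    by (simp add: d_def[symmetric])
  then obtain y where y: "\<And>n. y n \<in> V" "\<And>n. (norm (y n - g))\<^sup>2 < d + 1 / real (Suc n)"
    by metis
  have close: "(norm (y m - y n))\<^sup>2 \<le> 2 / real (Suc m) + 2 / real (Suc n)" for m n
  proof -
    have "(1/2) *\<^sub>R (y m + y n) \<in> V"
      using V(1) y(1) by (intro subspace_scale subspace_add) auto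
    note d_le[OF this]
    \<comment> \<open>the parallelogram law, with the midpoint of two almost closest points\<close>
    moreover have "(norm (y m - y n))\<^sup>2
        = 2 * (norm (y m - g))\<^sup>2 + 2 * (norm (y n - g))\<^sup>2
          - 4 * (norm ((1/2) *\<^sub>R (y m + y n) - g))\<^sup>2"
      unfolding power2_norm_eq_inner
      by (simp add: algebra_simps inner_commute)
    moreover have "2 / real (Suc n) = 2 * (1 / real (Suc n))" for n by simp
    ultimately show ?thesis using y(2)[of m] y(2)[of n] by linarith
  qed
  have "Cauchy y"
  proof (rule CauchyI)
    fix e :: real assume "0 < e"
    then obtain N where N: "4 / e\<^sup>2 < real N" using reals_Archimedean2 by blast
    then have N': "4 / real (Suc N) < e\<^sup>2"
      using \<open>0 < e\<close> by (simp add: field_simps add_strict_increasing)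
    have "norm (y m - y n) < e" if "N \<le> m" "N \<le> n" for m n
    proof -
      have "2 / real (Suc m) \<le> 2 / real (Suc N)" "2 / real (Suc n) \<le> 2 / real (Suc N)"
        using that by (auto intro!: divide_left_mono)
      then have "(norm (y m - y n))\<^sup>2 < e\<^sup>2" using close[of m n] N' by simp
      then show ?thesis using \<open>0 < e\<close> by (simp add: power_less_imp_less_base)
    qed
    then show "\<exists>M. \<forall>m\<ge>M. \<forall>n\<ge>M. norm (y m - y n) < e" by blast
  qed
  then obtain p where p: "y \<longlonglongrightarrow> p" using Cauchy_convergent convergent_def by blast
  have "p \<in> V" using closed_sequentially[OF V(2)] y(1) p by blast
  have "(norm (p - g))\<^sup>2 \<le> d"
  proof (rule LIMSEQ_le)
    show "(\<lambda>n. (norm (y n - g))\<^sup>2) \<longlonglongrightarrow> (norm (p - g))\<^sup>2"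
      by (intro tendsto_intros p)
    show "(\<lambda>n. d + 1 / real (Suc n)) \<longlonglongrightarrow> d"
      using tendsto_add[OF tendsto_const LIMSEQ_Suc[OF lim_1_over_n], of d] by simp
  qed (use y(2) in \<open>auto intro: less_imp_le\<close>)
  then have min: "(norm (p - g))\<^sup>2 \<le> (norm (v - g))\<^sup>2" if "v \<in> V" for v
    using d_le[OF that] by linarith
  have "inner (g - p) v = 0" if "v \<in> V" for v
  proof (cases "v = 0")
    case False
    \<comment> \<open>the size of the step along v that minimises the distance to g\<close>
    define s where "s = inner (g - p) v / inner v v"
    have "p + s *\<^sub>R v \<in> V"
      using V(1) \<open>p \<in> V\<close> that by (intro subspace_add subspace_scale)
    from min[OF this] have "2 * s * inner (g - p) v \<le> s\<^sup>2 * inner v v"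
      unfolding power2_norm_eq_inner
      by (simp add: algebra_simps inner_commute power2_eq_square)
    moreover have s: "s * inner v v = inner (g - p) v" using False by (simp add: s_def)
    ultimately have "s * inner (g - p) v \<le> 0"
      by (simp add: power2_eq_square mult.assoc)
    then have "(s * inner (g - p) v) * inner v v \<le> 0"
      by (rule mult_nonpos_nonneg) simp
    moreover have "(s * inner (g - p) v) * inner v v = (inner (g - p) v)\<^sup>2"
      using s by (metis mult.commute mult.left_commute power2_eq_square)
    ultimately have "(inner (g - p) v)\<^sup>2 \<le> 0" by simp
    then show ?thesis by simp
  qed simp
  with \<open>p \<in> V\<close> show ?thesis by blast
qed

text \<open>
  Two candidates differ by an element of \<open>V\<close> that is orthogonal to itself. This evaluates
  \<open>orth_proj\<close> from a guess for the projection, for instance 0 at a point orthogonal to \<open>V\<close>.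
\<close>

lemma orth_proj_unique:
  fixes V :: "'a::real_inner set"
  assumes V: "subspace V" and p: "p \<in> V" "\<And>v. v \<in> V \<Longrightarrow> inner (g - p) v = 0"
  shows "orth_proj V g = p"
  unfolding orth_proj_def
proof (rule the_equality)
  fix q assume q: "q \<in> V \<and> (\<forall>v\<in>V. inner (g - q) v = 0)"
  have "q - p \<in> V" using V p(1) q by (auto intro: subspace_diff)
  then have "inner (g - p) (q - p) = 0" "inner (g - q) (q - p) = 0" using p(2) q by auto
  then have "inner (q - p) (q - p) = 0" by (simp add: inner_diff_left)
  then show "q = p" by simp
qed (use p in auto)

lemma orth_proj_orthogonal:
  fixes V :: "'a::{real_inner, complete_space} set"
  assumes "subspace V" "closed V" "v \<in> V"
  shows "inner (g - orth_proj V g) v = 0"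
  using closed_subspace_orthogonal_decomposition[OF assms(1,2), of g]
    orth_proj_unique[OF assms(1)] assms(3) by metis

lemma subspace_ker: "subspace (ker A)"
  by (auto simp: ker_def subspace_def blinfun.add_right blinfun.scaleR_right)

lemma closed_ker: "closed (ker A)"
  unfolding ker_def by (intro closed_Collect_eq continuous_intros)

section \<open>The exponential series of a bounded operator\<close>

lemma blinfun_power_scaleR: "blinfun_power (t *\<^sub>R A) k = t ^ k *\<^sub>R blinfun_power A k"
  by (induction k) (auto simp: bounded_bilinear.scaleR_left[OF bounded_bilinear_blinfun_compose]
      bounded_bilinear.scaleR_right[OF bounded_bilinear_blinfun_compose])

lemma norm_blinfun_power_le: "norm (blinfun_power A k) \<le> norm A ^ k"
proof (induction k)
  case 0
  show ?case by (simp add: norm_blinfun_id_le)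
next
  case (Suc k)
  show ?case
    using norm_blinfun_compose[of A "blinfun_power A k"] mult_left_mono[OF Suc, of "norm A"]
    by simp
qed

lemma op_semigroup_series:
  "op_semigroup A t = (\<Sum>k. (t ^ k / fact k) *\<^sub>R blinfun_power A k)"
  by (simp add: op_semigroup_def blinfun_exp_def blinfun_power_scaleR divide_inverse_commute)

lemma summable_exp_real: "summable (\<lambda>k. (c::real) ^ k / fact k)"
  using summable_exp_generic[of c] by (simp add: divide_inverse_commute)

lemma summable_op_semigroup:
  fixes A :: "'a::banach \<Rightarrow>\<^sub>L 'a"
  shows "summable (\<lambda>k. (t ^ k / fact k) *\<^sub>R blinfun_power A k)"
proof (rule summable_comparison_test'[where N = 0])
  show "summable (\<lambda>k. (\<bar>t\<bar> * norm A) ^ k / fact k)" by (rule summable_exp_real)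
  show "norm ((t ^ k / fact k) *\<^sub>R blinfun_power A k) \<le> (\<bar>t\<bar> * norm A) ^ k / fact k" for k
    using mult_left_mono[OF norm_blinfun_power_le[of A k], of "\<bar>t\<bar> ^ k"]
    by (simp add: power_mult_distrib power_abs divide_right_mono)
qed

lemma op_semigroup_0:
  fixes A :: "'a::banach \<Rightarrow>\<^sub>L 'a"
  shows "op_semigroup A 0 = id_blinfun"
proof -
  have "(\<lambda>k. ((0::real) ^ k / fact k) *\<^sub>R blinfun_power A k) = (\<lambda>k. if k = 0 then id_blinfun else 0)"
    by (auto simp: fun_eq_iff)
  then show ?thesis
    unfolding op_semigroup_series
    using sums_unique[OF sums_single[of 0 "\<lambda>_. id_blinfun :: 'a \<Rightarrow>\<^sub>L 'a"]] by simp
qed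

text \<open>
  On the interval \<open>\<bar>s\<bar> < R\<close> the series of derivatives is dominated by the exponential series of the
  number \<open>R * norm A\<close>, so it converges uniformly and termwise differentiation is legitimate.
  Differentiation shifts the index by one, which pulls out one factor \<open>A\<close>.
\<close>

lemma op_semigroup_has_vector_derivative:
  fixes A :: "'a::banach \<Rightarrow>\<^sub>L 'a"
  shows "(op_semigroup A has_vector_derivative A o\<^sub>L op_semigroup A t) (at t)"
proof -
  define R where "R = \<bar>t\<bar> + 1"
  define S where "S = ball (0::real) R"
  have S: "convex S" "open S" "t \<in> S" by (auto simp: S_def R_def)
  define f where "f k s = (s ^ k / fact k) *\<^sub>R blinfun_power A k" for k and s :: real
  \<comment> \<open>the derivative of f k; the constant term f 0 contributes nothing\<close>
  define f' where "f' k s = (case k of 0 \<Rightarrow> 0 | Suc j \<Rightarrow> A o\<^sub>L f j s)" for k s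
  define G where "G s = (\<Sum>k. f' k s)" for s
  have G: "G s = A o\<^sub>L op_semigroup A s" for s
  proof -
    have "(\<lambda>k. f k s) sums op_semigroup A s"
      using summable_op_semigroup[of s A] by (simp add: op_semigroup_series f_def summable_sums)
    from bounded_linear.sums[OF bounded_bilinear.bounded_linear_right[OF bounded_bilinear_blinfun_compose] this]
    have "(\<lambda>k. f' (Suc k) s) sums (A o\<^sub>L op_semigroup A s)"
      by (simp add: f'_def)
    then have "(\<lambda>k. f' k s) sums (A o\<^sub>L op_semigroup A s)"
      by (subst (asm) sums_Suc_iff) (simp add: f'_def)
    then show ?thesis by (simp add: G_def sums_iff)
  qed
  define M where "M k = (case k of 0 \<Rightarrow> 0 | Suc j \<Rightarrow> norm A * ((R * norm A) ^ j / fact j))" for k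
  have "summable M"
    using summable_mult[OF summable_exp_real[of "R * norm A"], of "norm A"]
    by (subst summable_Suc_iff[symmetric]) (simp add: M_def del: summable_Suc_iff)
  have unif: "uniform_limit S (\<lambda>n s. \<Sum>i<n. f' i s) G sequentially"
    unfolding G_def
  proof (rule Weierstrass_m_test)
    show "summable M" by fact
    fix n s assume "s \<in> S"
    then have s: "\<bar>s\<bar> \<le> R" by (simp add: S_def)
    show "norm (f' n s) \<le> M n"
    proof (cases n)
      case (Suc j)
      have "norm (f j s) = \<bar>s\<bar> ^ j * norm (blinfun_power A j) / fact j"
        by (simp add: f_def power_abs)
      also have "\<dots> \<le> R ^ j * norm A ^ j / fact j"
        using s by (intro divide_right_mono mult_mono power_mono norm_blinfun_power_le) auto
      finally have "norm A * norm (f j s) \<le> norm A * ((R * norm A) ^ j / fact j)"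
        by (intro mult_left_mono) (auto simp: power_mult_distrib)
      then show ?thesis
        using norm_blinfun_compose[of A "f j s"] by (simp add: f'_def M_def Suc)
    qed (simp add: f'_def M_def)
  qed
  have deriv: "(f k has_derivative (\<lambda>h. h *\<^sub>R f' k s)) (at s within S)" for k s
  proof (cases k)
    case 0
    have "f 0 = (\<lambda>_. id_blinfun)" by (simp add: f_def fun_eq_iff)
    with 0 show ?thesis by (simp add: f'_def)
  next
    case (Suc j)
    have "((\<lambda>s. s ^ Suc j / fact (Suc j)) has_field_derivative (s ^ j / fact j)) (at s within S)"
    proof -
      have "real (Suc j) * s ^ j / fact (Suc j) = s ^ j / fact j"
        unfolding fact_Suc of_nat_mult by (simp del: of_nat_Suc)
      then show ?thesis using DERIV_cdivide[OF DERIV_pow[of "Suc j" s S], of "fact (Suc j)"]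
        by (simp del: fact_Suc of_nat_Suc)
    qed
    from has_vector_derivative_scaleR[OF this has_vector_derivative_const[of "blinfun_power A (Suc j)"]]
    have "(f k has_vector_derivative f' k s) (at s within S)"
      by (simp add: f_def[abs_def] f'_def Suc
          bounded_bilinear.scaleR_right[OF bounded_bilinear_blinfun_compose])
    then show ?thesis by (simp add: has_vector_derivative_def)
  qed
  have "\<exists>F. \<forall>s\<in>S. (\<lambda>k. f k s) sums F s \<and> (F has_derivative (\<lambda>h. h *\<^sub>R G s)) (at s within S)"
  proof (rule has_derivative_series[where f' = "\<lambda>k s h. h *\<^sub>R f' k s"])
    fix e :: real assume "0 < e"
    from uniform_limitD[OF unif this]
    show "\<forall>\<^sub>F n in sequentially. \<forall>s\<in>S. \<forall>h. norm ((\<Sum>i<n. h *\<^sub>R f' i s) - h *\<^sub>R G s) \<le> e * norm h"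
    proof eventually_elim
      case (elim n)
      show ?case
      proof (intro ballI allI)
        fix s h assume "s \<in> S"
        have "norm ((\<Sum>i<n. h *\<^sub>R f' i s) - h *\<^sub>R G s) = \<bar>h\<bar> * norm ((\<Sum>i<n. f' i s) - G s)"
          by (simp flip: scaleR_sum_right scaleR_diff_right)
        also have "\<dots> \<le> \<bar>h\<bar> * e"
          using elim \<open>s \<in> S\<close> by (intro mult_left_mono) (auto simp: dist_norm intro: less_imp_le)
        finally show "norm ((\<Sum>i<n. h *\<^sub>R f' i s) - h *\<^sub>R G s) \<le> e * norm h"
          by (simp add: mult.commute)
      qed
    qed
  next
    show "(\<lambda>k. f k t) sums op_semigroup A t"
      using summable_op_semigroup[of t A] by (simp add: op_semigroup_series f_def summable_sums)
  qed (use S deriv in auto)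
  then obtain F where F: "\<And>s. s \<in> S \<Longrightarrow> (\<lambda>k. f k s) sums F s"
      "\<And>s. s \<in> S \<Longrightarrow> (F has_derivative (\<lambda>h. h *\<^sub>R G s)) (at s within S)"
    by blast
  have "F s = op_semigroup A s" if "s \<in> S" for s
    using F(1)[OF that] by (simp add: op_semigroup_series f_def sums_iff)
  moreover have "(F has_derivative (\<lambda>h. h *\<^sub>R G t)) (at t)"
    using F(2)[OF S(3)] at_within_open[OF S(3,2)] by simp
  ultimately have "(op_semigroup A has_derivative (\<lambda>h. h *\<^sub>R G t)) (at t)"
    by (auto intro: has_derivative_transform_within_open[OF _ S(2,3)])
  then show ?thesis by (simp add: has_vector_derivative_def G)
qed

lemma op_semigroup_orbit_has_vector_derivative:
  fixes A :: "'a::banach \<Rightarrow>\<^sub>L 'a"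
  shows "((\<lambda>t. op_semigroup A t h) has_vector_derivative A (op_semigroup A t h)) (at t)"
  using bounded_linear.has_vector_derivative[OF
      bounded_bilinear.bounded_linear_left[OF bounded_bilinear_blinfun_apply, of h]
      op_semigroup_has_vector_derivative[of A t]]
  by simp

section \<open>Decay of orbits orthogonal to the kernel\<close>

text \<open>
  Since \<open>inner (A x) k = inner x (A k) = 0\<close>, the component of an orbit along the kernel is a
  conserved quantity.
\<close>

lemma op_semigroup_orthogonal_ker:
  fixes A :: "'a::{real_inner, banach} \<Rightarrow>\<^sub>L 'a"
  assumes A: "self_adjoint A" and k: "k \<in> ker A" and h: "inner h k = 0"
  shows "inner (op_semigroup A t h) k = 0"
proof -
  have "((\<lambda>s. inner (op_semigroup A s h) k) has_field_derivative 0) (at s)" for s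
  proof -
    have "inner (A (op_semigroup A s h)) k = 0"
      using A k by (simp add: self_adjoint_def ker_def)
    with bounded_linear.has_vector_derivative[OF bounded_linear_inner_left
        op_semigroup_orbit_has_vector_derivative[of A h s], of k]
    show ?thesis by (simp add: has_real_derivative_iff_has_vector_derivative)
  qed
  then have "inner (op_semigroup A t h) k = inner (op_semigroup A 0 h) k"
    using DERIV_isconst_all by blast
  then show ?thesis using h by (simp add: op_semigroup_0)
qed

text \<open>
  Gronwall's inequality for the squared norm: weighted with the integrating factor
  \<open>exp (2 * c * s)\<close>, it is nonincreasing.
\<close>

lemma exp_decay_of_energy_inequality:
  fixes u :: "real \<Rightarrow> 'a::real_inner"
  assumes u: "\<And>s. (u has_vector_derivative u' s) (at s)"
    and le: "\<And>s. inner (u' s) (u s) \<le> - c * (norm (u s))\<^sup>2"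
    and t: "0 \<le> t"
  shows "norm (u t) \<le> exp (- c * t) * norm (u 0)"
proof -
  define E where "E s = exp (2 * c * s) * (norm (u s))\<^sup>2" for s
  have "\<exists>y. (E has_real_derivative y) (at s) \<and> y \<le> 0" for s
  proof -
    have "((\<lambda>s. inner (u s) (u s)) has_real_derivative 2 * inner (u' s) (u s)) (at s)"
      using bounded_bilinear.has_vector_derivative[OF bounded_bilinear_inner u u]
      by (simp add: has_real_derivative_iff_has_vector_derivative inner_commute)
    then have "(E has_real_derivative
        exp (2 * c * s) * (2 * inner (u' s) (u s) + 2 * c * (norm (u s))\<^sup>2)) (at s)"
      unfolding E_def power2_norm_eq_inner
      by (auto intro!: derivative_eq_intros simp: algebra_simps)
    moreover have "exp (2 * c * s) * (2 * inner (u' s) (u s) + 2 * c * (norm (u s))\<^sup>2) \<le> 0"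
      using le[of s] by (intro mult_nonneg_nonpos) auto
    ultimately show ?thesis by blast
  qed
  then have "E t \<le> E 0" using t by (intro DERIV_nonpos_imp_nonincreasing[of 0 t E]) auto
  then have "exp (2 * c * t) * (norm (u t))\<^sup>2 \<le> (norm (u 0))\<^sup>2" by (simp add: E_def)
  then have "exp (- 2 * c * t) * (exp (2 * c * t) * (norm (u t))\<^sup>2)
      \<le> exp (- 2 * c * t) * (norm (u 0))\<^sup>2"
    by (intro mult_left_mono) auto
  moreover have "exp (- 2 * c * t) * exp (2 * c * t) = 1"
    by (simp flip: exp_add)
  moreover have "exp (- 2 * c * t) = (exp (- c * t))\<^sup>2"
    by (simp flip: exp_double)
  ultimately have "(norm (u t))\<^sup>2 \<le> (exp (- c * t) * norm (u 0))\<^sup>2"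
    by (simp only: mult.assoc[symmetric] power_mult_distrib mult_1_left)
  then show ?thesis by (rule power2_le_imp_le) simp
qed

text \<open>
  The gap inequality is applied at every point of the orbit, not only at its start; conservation
  of the kernel component makes the projection vanish there.
\<close>

lemma op_semigroup_exp_decay:
  fixes A :: "'a::{real_inner, banach} \<Rightarrow>\<^sub>L 'a"
  assumes A: "self_adjoint A"
    and gap: "\<And>h. c * (norm (h - orth_proj (ker A) h))\<^sup>2 \<le> - inner (A h) h"
    and h: "\<And>k. k \<in> ker A \<Longrightarrow> inner h k = 0"
    and t: "0 \<le> t"
  shows "norm (op_semigroup A t h) \<le> exp (- c * t) * norm h"
proof -
  have "inner (A (op_semigroup A s h)) (op_semigroup A s h) \<le> - c * (norm (op_semigroup A s h))\<^sup>2"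
    for s
  proof -
    have "orth_proj (ker A) (op_semigroup A s h) = 0"
      using op_semigroup_orthogonal_ker[OF A _ h]
      by (intro orth_proj_unique subspace_ker subspace_0) auto
    then show ?thesis using gap[of "op_semigroup A s h"] by simp
  qed
  from exp_decay_of_energy_inequality[OF op_semigroup_orbit_has_vector_derivative this t]
  show ?thesis by (simp add: op_semigroup_0)
qed

theorem corollary4p6:
  fixes \<mu> gap t :: real and L :: "wL2 \<Rightarrow>\<^sub>L wL2" and g :: wL2
  assumes "\<mu> > 0"
    and "is_L \<mu> L"
    and "gap > 0"
    and "\<And>h. - inner (blinfun_apply L h) h \<ge> gap * (norm (h - orth_proj (ker L) h))\<^sup>2"
    and "t \<ge> 0"
  shows "norm (blinfun_apply (op_semigroup L t) (g - orth_proj (ker L) g))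
           \<le> exp (- gap * t) * norm (g - orth_proj (ker L) g)"
proof (rule op_semigroup_exp_decay)
  show "self_adjoint L" using assms(2) by (simp add: is_L_def)
  show "inner (g - orth_proj (ker L) g) k = 0" if "k \<in> ker L" for k
    using that by (intro orth_proj_orthogonal subspace_ker closed_ker)
qed (use assms in auto)

end
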